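(* Let $X$ be a quasi-Banach function lattice over a metric measure space $(\mathcal P,d,\mu)$. If $u\in DX$, i.e., $u$ is a measurable function on $\mathcal P$ which has an upper gradient in $X$, then $u\in\mathrm{ACC}_X(\mathcal P)$, i.e., $u$ is absolutely continuous on $\mathrm{Mod}_X$-a.e. curve.
   Context: Standing setting: $(\mathcal P,d)$ is a metric space with a $\sigma$-finite Borel regular measure $\mu$ (Borel sets are $\mu$-measurable, and each $\mu$-measurable set $A$ is contained in a Borel set $D$ with $\mu(D)=\mu(A)$), such that every ball has finite positive measure. $\mathcal M(\mathcal P,\mu)$ is the set of extended real-valued $\mu$-measurable functions on $\mathcal P$ (defined everywhere). A quasi-Banach function lattice $X$ is given by a functional $\|\cdot\|_X:\mathcal M(\mathcal P,\mu)\to[0,\infty]$ with $X=\{u\in\mathcal M(\mathcal P,\mu):\|u\|_X<\infty\}$ such that, for some constant $c\ge1$ (the modulus of concavity): (i) $\|u\|_X=0$ iff $u=0$ a.e.; $\|au\|_X=|a|\,\|u\|_X$ for $a\in\mathbb R$; $\|u+v\|_X\le c(\|u\|_X+\|v\|_X)$; (ii) $|u|\le|v|$ a.e. implies $\|u\|_X\le\|v\|_X$; (iii) (Riesz–Fischer) if $u_n\ge0$ a.e. for all $n\ge 1$, then $\bigl\|\sum_{n=1}^\infty u_n\bigr\|_X\le\sum_{n=1}^\infty c^n\|u_n\|_X$. Moreover, $\|\cdot\|_X$ is assumed continuous: $\|u_n-u\|_X\to0$ implies $\|u_n\|_X\to\|u\|_X$. Elements of $X$ are functions defined everywhere, not a.e.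 equivalence classes. A curve is a non-constant rectifiable continuous map from a compact interval to $\mathcal P$, always parametrized by arc length, $\gamma:[0,l_\gamma]\to\mathcal P$. A Borel function $g:\mathcal P\to[0,\infty]$ is an upper gradient of $u:\mathcal P\to\overline{\mathbb R}=\mathbb{R}\cup\{\pm\infty\}$ if $|u(\gamma(0))-u(\gamma(l_\gamma))|\le\int_\gamma g\,ds$ for all curves $\gamma$, with the convention $|(\pm\infty)-(\pm\infty)|=\infty$. For a family $\Gamma$ of curves, $\mathrm{Mod}_X(\Gamma)=\inf\|\rho\|_X$ over all non-negative Borel functions $\rho$ with $\int_\gamma\rho\,ds\ge1$ for all $\gamma\in\Gamma$. A claim holds for $\mathrm{Mod}_X$-a.e. curve if the family of exceptional curves has zero $X$-modulus. A function $u:\mathcal P\to\overline{\mathbb R}$ belongs to $\mathrm{ACC}_X(\mathcal P)$ if for all curves $\gamma:[0,l_\gamma]\to\mathcal P$, except perhaps for a family of curves of zero $X$-modulus, $u\circ\gamma$ is real-valued and absolutely continuous on $[0,l_\gamma]$. *)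

theory Defs
  imports "HOL-Analysis.Analysis"
begin

section \<open>Metric measure spaces and quasi-Banach function lattices\<close>

text \<open>
  The metric space is the whole type \<open>'a\<close>. The \<open>\<mu>\<close>-measurable sets are \<^term>\<open>sets M\<close>, which may
  be larger than the Borel sets; no completeness of \<open>M\<close> is imposed.
\<close>

locale borel_regular_metric_measure_space = sigma_finite_measure M
  for M :: "'a::metric_space measure" +
  assumes space_eq_UNIV: "space M = UNIV"
    and borel_sets_measurable: "sets borel \<subseteq> sets M"
    and borel_regular:
      "A \<in> sets M \<Longrightarrow> \<exists>D\<in>sets borel. A \<subseteq> D \<and> emeasure M D = emeasure M A"
    and ball_measure_pos: "0 < r \<Longrightarrow> 0 < emeasure M (ball x r)"
    and ball_measure_finite: "0 < r \<Longrightarrow> emeasure M (ball x r) < \<infinity>"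

text \<open>
  \<^term>\<open>borel_measurable M :: ('a \<Rightarrow> ereal) set\<close> is the set of extended real-valued measurable
  functions, defined everywhere. The functional \<open>N\<close> is constrained on that set only.

  In \<^typ>\<open>ereal\<close> the sum \<open>\<infinity> + (-\<infinity>)\<close> has the value \<open>\<infinity>\<close>. This choice does not affect
  \<open>norm_add\<close> and \<open>norm_continuous\<close>: by \<open>norm_scale\<close>, \<open>norm_mono\<close> and \<open>norm_eq_0_iff\<close>, a function
  of finite quasi-norm is finite almost everywhere. Similarly, in \<open>riesz_fischer\<close> the sum is a
  sum of non-negative terms outside a null set, and values on a null set are irrelevant by
  \<open>norm_mono\<close>. There \<open>w n\<close> is the term of index \<open>n + 1\<close> of a sequence starting at index \<open>1\<close>,
  whence the weight \<open>c ^ Suc n\<close>.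
\<close>

locale quasi_banach_function_lattice = borel_regular_metric_measure_space M
  for M :: "'a::metric_space measure" +
  fixes N :: "('a \<Rightarrow> ereal) \<Rightarrow> ennreal" and c :: real
  assumes modulus_ge_1: "1 \<le> c"
    and norm_eq_0_iff:
      "u \<in> borel_measurable M \<Longrightarrow> N u = 0 \<longleftrightarrow> (AE x in M. u x = 0)"
    and norm_scale:
      "u \<in> borel_measurable M \<Longrightarrow> N (\<lambda>x. ereal a * u x) = ennreal \<bar>a\<bar> * N u"
    and norm_add:
      "u \<in> borel_measurable M \<Longrightarrow> v \<in> borel_measurable M \<Longrightarrow>
        N (\<lambda>x. u x + v x) \<le> ennreal c * (N u + N v)"
    and norm_mono:
      "u \<in> borel_measurable M \<Longrightarrow> v \<in> borel_measurable M \<Longrightarrow>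
        (AE x in M. \<bar>u x\<bar> \<le> \<bar>v x\<bar>) \<Longrightarrow> N u \<le> N v"
    and riesz_fischer:
      "(\<And>n. w n \<in> borel_measurable M) \<Longrightarrow> (\<And>n. AE x in M. 0 \<le> w n x) \<Longrightarrow>
        N (\<lambda>x. \<Sum>n. w n x) \<le> (\<Sum>n. ennreal (c ^ Suc n) * N (w n))"
    and norm_continuous:
      "(\<And>n. w n \<in> borel_measurable M) \<Longrightarrow> u \<in> borel_measurable M \<Longrightarrow>
        (\<lambda>n. N (\<lambda>x. w n x - u x)) \<longlonglongrightarrow> 0 \<Longrightarrow> (\<lambda>n. N (w n)) \<longlonglongrightarrow> N u"

definition lattice_space :: "'a measure \<Rightarrow> (('a \<Rightarrow> ereal) \<Rightarrow> ennreal) \<Rightarrow> ('a \<Rightarrow> ereal) set" where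
  "lattice_space M N = {u \<in> borel_measurable M. N u < \<infinity>}"


section \<open>Curves\<close>

definition path_variation :: "(real \<Rightarrow> 'a::metric_space) \<Rightarrow> real \<Rightarrow> real \<Rightarrow> ennreal" where
  "path_variation \<gamma> a b =
    (SUP (n, t) \<in> {(n::nat, t::nat \<Rightarrow> real). mono_on {..n} t \<and> t ` {..n} \<subseteq> {a..b}}.
       \<Sum>i<n. ennreal (dist (\<gamma> (t i)) (\<gamma> (t (Suc i)))))"

text \<open>
  A curve \<open>\<gamma> : [0, l] \<rightarrow> 'a\<close>, parametrized by arc length, is represented by \<open>\<gamma>\<close> and \<open>l\<close>. The values
  of \<open>\<gamma>\<close> outside \<open>[0, l]\<close> play no role.
\<close>

definition is_curve :: "(real \<Rightarrow> 'a::metric_space) \<Rightarrow> real \<Rightarrow> bool" where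
  "is_curve \<gamma> l \<longleftrightarrow>
    0 \<le> l \<and> continuous_on {0..l} \<gamma> \<and> \<not> \<gamma> constant_on {0..l} \<and>
    path_variation \<gamma> 0 l < \<infinity> \<and>
    (\<forall>t\<in>{0..l}. path_variation \<gamma> 0 t = ennreal t)"

definition curve_integral :: "('a \<Rightarrow> ennreal) \<Rightarrow> (real \<Rightarrow> 'a) \<Rightarrow> real \<Rightarrow> ennreal" where
  "curve_integral g \<gamma> l = (\<integral>\<^sup>+t\<in>{0..l}. g (\<gamma> t) \<partial>lborel)"


section \<open>Upper gradients\<close>

text \<open>Subtraction on \<^typ>\<open>ereal\<close> obeys the convention \<open>\<bar>(\<plusminus>\<infinity>) - (\<plusminus>\<infinity>)\<bar> = \<infinity>\<close>.\<close>

lemma ereal_abs_diff_infinite: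
  fixes x y :: ereal
  assumes "\<bar>x\<bar> = \<infinity> \<or> \<bar>y\<bar> = \<infinity>"
  shows "\<bar>x - y\<bar> = \<infinity>"
  using assms by (cases x; cases y) auto

definition upper_gradient :: "('a::metric_space \<Rightarrow> ennreal) \<Rightarrow> ('a \<Rightarrow> ereal) \<Rightarrow> bool" where
  "upper_gradient g u \<longleftrightarrow>
    g \<in> borel_measurable borel \<and>
    (\<forall>\<gamma> l. is_curve \<gamma> l \<longrightarrow> \<bar>u (\<gamma> 0) - u (\<gamma> l)\<bar> \<le> enn2ereal (curve_integral g \<gamma> l))"

definition DX :: "'a::metric_space measure \<Rightarrow> (('a \<Rightarrow> ereal) \<Rightarrow> ennreal) \<Rightarrow> ('a \<Rightarrow> ereal) set" where
  "DX M N = {u \<in> borel_measurable M.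
     \<exists>g. upper_gradient g u \<and> (\<lambda>x. enn2ereal (g x)) \<in> lattice_space M N}"


section \<open>Modulus of curve families\<close>

definition curve_modulus ::
  "(('a::metric_space \<Rightarrow> ereal) \<Rightarrow> ennreal) \<Rightarrow> ((real \<Rightarrow> 'a) \<times> real) set \<Rightarrow> ennreal" where
  "curve_modulus N \<Gamma> =
    (INF \<rho> \<in> {\<rho> \<in> borel_measurable borel. \<forall>(\<gamma>, l)\<in>\<Gamma>. 1 \<le> curve_integral \<rho> \<gamma> l}.
       N (\<lambda>x. enn2ereal (\<rho> x)))"

definition ae_curve ::
  "(('a::metric_space \<Rightarrow> ereal) \<Rightarrow> ennreal) \<Rightarrow> ((real \<Rightarrow> 'a) \<Rightarrow> real \<Rightarrow> bool) \<Rightarrow> bool" where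
  "ae_curve N P \<longleftrightarrow> curve_modulus N {(\<gamma>, l). is_curve \<gamma> l \<and> \<not> P \<gamma> l} = 0"


section \<open>Absolute continuity on curves\<close>

definition absolutely_continuous_on :: "real set \<Rightarrow> (real \<Rightarrow> real) \<Rightarrow> bool" where
  "absolutely_continuous_on S f \<longleftrightarrow>
    (\<forall>\<epsilon>>0. \<exists>\<delta>>0. \<forall>D :: (real \<times> real) set.
       finite D \<and> (\<forall>(a, b)\<in>D. a < b \<and> {a..b} \<subseteq> S) \<and>
       disjoint_family_on (\<lambda>(a, b). {a<..<b}) D \<and>
       (\<Sum>(a, b)\<in>D. b - a) < \<delta> \<longrightarrow>
       (\<Sum>(a, b)\<in>D. \<bar>f b - f a\<bar>) < \<epsilon>)"

definition ACC :: "(('a::metric_space \<Rightarrow> ereal) \<Rightarrow> ennreal) \<Rightarrow> ('a \<Rightarrow> ereal) set" where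
  "ACC N = {u. ae_curve N (\<lambda>\<gamma> l.
     (\<forall>t\<in>{0..l}. \<bar>u (\<gamma> t)\<bar> \<noteq> \<infinity>) \<and>
     absolutely_continuous_on {0..l} (\<lambda>t. real_of_ereal (u (\<gamma> t))))}"

end

theory Submission
  imports Defs
begin

text \<open>
  The curves along which an upper gradient \<open>g \<in> X\<close> of \<open>u\<close> has infinite integral form a family of
  modulus zero, because every multiple \<open>g / n\<close> is admissible for it. Every other curve \<open>\<gamma>\<close> is good:
  its subcurves are again curves parametrized by arc length, so \<open>\<bar>u (\<gamma> a) - u (\<gamma> b)\<bar>\<close> is at most the
  integral of \<open>g \<circ> \<gamma>\<close> over \<open>[a, b]\<close>, and absolute continuity of the integral concludes.
\<close>

section \<open>Length of subcurves\<close>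

text \<open>Adding a constant commutes with a supremum in \<open>ennreal\<close> only over a
  nonempty index set. This form lets a sum of two variations be bounded one partition at a
  time.\<close>

lemma path_variation_add_leI:
  assumes "a \<le> b"
    and "\<And>n t. mono_on {..n} t \<Longrightarrow> t ` {..n} \<subseteq> {a..b} \<Longrightarrow>
      (\<Sum>i<n. ennreal (dist (\<gamma> (t i)) (\<gamma> (t (Suc i))))) + B \<le> C"
  shows "path_variation \<gamma> a b + B \<le> C"
proof -
  \<comment> \<open>The one-point partition at \<open>a\<close> lies in the index set; this is where
    \<open>a \<le> b\<close> enters.\<close>
  have "{(n::nat, t::nat \<Rightarrow> real). mono_on {..n} t \<and> t ` {..n} \<subseteq> {a..b}} \<noteq> {}"
    using assms(1) by (auto simp: mono_on_def intro!: exI[of _ "0::nat"] exI[of _ "\<lambda>_. a"])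
  then show ?thesis
    unfolding path_variation_def
    by (subst ennreal_SUP_add_left[symmetric]) (use assms(2) in \<open>auto intro!: SUP_least simp del: sum_ennreal\<close>)
qed

lemma path_variation_leI:
  assumes "\<And>n t. mono_on {..n} t \<Longrightarrow> t ` {..n} \<subseteq> {a..b} \<Longrightarrow>
      (\<Sum>i<n. ennreal (dist (\<gamma> (t i)) (\<gamma> (t (Suc i))))) \<le> B"
  shows "path_variation \<gamma> a b \<le> B"
  unfolding path_variation_def by (rule SUP_least) (use assms in auto)

lemma sum_le_path_variation:
  assumes "mono_on {..n} t" "t ` {..n} \<subseteq> {a..b}"
  shows "(\<Sum>i<n. ennreal (dist (\<gamma> (t i)) (\<gamma> (t (Suc i))))) \<le> path_variation \<gamma> a b"
  unfolding path_variation_def by (rule SUP_upper2[where i = "(n, t)"]) (use assms in auto)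

lemma path_variation_cong:
  fixes \<gamma> \<delta> :: "real \<Rightarrow> 'a::metric_space"
  assumes "\<And>x. x \<in> {a..b} \<Longrightarrow> \<gamma> x = \<delta> x"
  shows "path_variation \<gamma> a b = path_variation \<delta> a b"
proof -
  have "path_variation \<gamma> a b \<le> path_variation \<delta> a b"
    if eq: "\<And>x. x \<in> {a..b} \<Longrightarrow> \<gamma> x = \<delta> x" for \<gamma> \<delta> :: "real \<Rightarrow> 'a"
  proof (rule path_variation_leI)
    fix n and t :: "nat \<Rightarrow> real" assume *: "mono_on {..n} t" "t ` {..n} \<subseteq> {a..b}"
    have "(\<Sum>i<n. ennreal (dist (\<gamma> (t i)) (\<gamma> (t (Suc i)))))
        = (\<Sum>i<n. ennreal (dist (\<delta> (t i)) (\<delta> (t (Suc i)))))"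
      using * eq by (intro sum.cong) (auto simp: image_subset_iff)
    then show "(\<Sum>i<n. ennreal (dist (\<gamma> (t i)) (\<gamma> (t (Suc i))))) \<le> path_variation \<delta> a b"
      using sum_le_path_variation[OF *] by simp
  qed
  from this[of \<gamma> \<delta>] this[of \<delta> \<gamma>] show ?thesis using assms by (simp add: antisym)
qed

text \<open>Serves in contrapositive form: positive length forces a subcurve to be
  non-constant.\<close>

lemma path_variation_constant:
  assumes "\<gamma> constant_on {a..b}"
  shows "path_variation \<gamma> a b = 0"
proof -
  obtain k where "\<And>x. x \<in> {a..b} \<Longrightarrow> \<gamma> x = k"
    using assms by (auto simp: constant_on_def)
  then have "path_variation \<gamma> a b = path_variation (\<lambda>_. k) a b"
    by (rule path_variation_cong)
  also have "\<dots> \<le> 0" by (rule path_variation_leI) simp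
  finally show ?thesis by simp
qed

lemma path_variation_shift:
  fixes \<gamma> :: "real \<Rightarrow> 'a::metric_space"
  shows "path_variation (\<lambda>x. \<gamma> (x + h)) a b = path_variation \<gamma> (a + h) (b + h)"
proof -
  have *: "path_variation (\<lambda>x. \<gamma> (x + h)) a b \<le> path_variation \<gamma> (a + h) (b + h)"
    for \<gamma> :: "real \<Rightarrow> 'a" and a b h
  proof (rule path_variation_leI)
    fix n and t :: "nat \<Rightarrow> real" assume "mono_on {..n} t" "t ` {..n} \<subseteq> {a..b}"
    then show "(\<Sum>i<n. ennreal (dist (\<gamma> (t i + h)) (\<gamma> (t (Suc i) + h))))
        \<le> path_variation \<gamma> (a + h) (b + h)"
      by (intro sum_le_path_variation[of n "\<lambda>i. t i + h"])
        (auto simp: mono_on_def image_subset_iff)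
  qed
  show ?thesis
    \<comment> \<open>The reverse inequality is the same one for the translated path and the shift
      \<open>- h\<close>.\<close>
    using *[of \<gamma> h a b] *[of "\<lambda>x. \<gamma> (x + h)" "- h" "a + h" "b + h"] by simp
qed

text \<open>For \<le>, a partition of the whole interval is clamped to either side of
  \<open>b\<close>, and the triangle inequality splits the step that crosses \<open>b\<close>. For
  \<ge>, partitions of the two halves are concatenated.\<close>

lemma path_variation_add:
  assumes "a \<le> b" "b \<le> c"
  shows "path_variation \<gamma> a c = path_variation \<gamma> a b + path_variation \<gamma> b c"
proof (rule antisym)
  show "path_variation \<gamma> a c \<le> path_variation \<gamma> a b + path_variation \<gamma> b c"
  proof (rule path_variation_leI)
    fix n and t :: "nat \<Rightarrow> real" assume t: "mono_on {..n} t" "t ` {..n} \<subseteq> {a..c}"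
    \<comment> \<open>Clamping keeps the number of steps: those on the wrong side of
      \<open>b\<close> collapse to the point \<open>b\<close> and contribute zero, so
      \<open>b\<close> need not be inserted into the partition.\<close>
    define p where "p i = min (t i) b" for i
    define q where "q i = max (t i) b" for i
    have step: "dist (\<gamma> (t i)) (\<gamma> (t (Suc i)))
        \<le> dist (\<gamma> (p i)) (\<gamma> (p (Suc i))) + dist (\<gamma> (q i)) (\<gamma> (q (Suc i)))" if "i < n" for i
    proof -
      have "t i \<le> t (Suc i)" using t(1) that by (auto simp: mono_on_def)
      then show ?thesis
        using dist_triangle[of "\<gamma> (t i)" "\<gamma> (t (Suc i))" "\<gamma> b"]
        by (auto simp: p_def q_def min_def max_def)
    qed
    have "(\<Sum>i<n. ennreal (dist (\<gamma> (t i)) (\<gamma> (t (Suc i)))))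
        \<le> (\<Sum>i<n. ennreal (dist (\<gamma> (p i)) (\<gamma> (p (Suc i))))
              + ennreal (dist (\<gamma> (q i)) (\<gamma> (q (Suc i)))))"
      using step by (intro sum_mono) (simp add: ennreal_plus[symmetric] del: ennreal_plus)
    also have "\<dots> \<le> path_variation \<gamma> a b + path_variation \<gamma> b c"
      unfolding sum.distrib
    proof (intro add_mono sum_le_path_variation)
      show "mono_on {..n} p" "mono_on {..n} q"
        using t(1) by (fastforce simp: mono_on_def p_def q_def min_def max_def)+
      show "p ` {..n} \<subseteq> {a..b}" "q ` {..n} \<subseteq> {b..c}"
        using t(2) assms by (auto simp: p_def q_def image_subset_iff)
    qed
    finally show "(\<Sum>i<n. ennreal (dist (\<gamma> (t i)) (\<gamma> (t (Suc i)))))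
        \<le> path_variation \<gamma> a b + path_variation \<gamma> b c" .
  qed
next
  have concat: "(\<Sum>i<n. ennreal (dist (\<gamma> (t i)) (\<gamma> (t (Suc i)))))
      + (\<Sum>i<m. ennreal (dist (\<gamma> (s i)) (\<gamma> (s (Suc i))))) \<le> path_variation \<gamma> a c"
    if t: "mono_on {..n} t" "t ` {..n} \<subseteq> {a..b}" and s: "mono_on {..m} s" "s ` {..m} \<subseteq> {b..c}"
    for n m :: nat and t s :: "nat \<Rightarrow> real"
  proof -
    \<comment> \<open>The last point of \<open>t\<close> and the first point of \<open>s\<close> may
      differ, so both are kept. The step of index \<open>n\<close> joins them; it belongs to neither
      sum and can only increase the total.\<close>
    define r where "r i = (if i \<le> n then t i else s (i - Suc n))" for i
    have "(\<Sum>i<n. ennreal (dist (\<gamma> (t i)) (\<gamma> (t (Suc i)))))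
        = (\<Sum>i<n. ennreal (dist (\<gamma> (r i)) (\<gamma> (r (Suc i)))))"
      by (intro sum.cong) (auto simp: r_def)
    moreover have "(\<Sum>i<m. ennreal (dist (\<gamma> (s i)) (\<gamma> (s (Suc i)))))
        = (\<Sum>i=Suc n..<Suc n + m. ennreal (dist (\<gamma> (r i)) (\<gamma> (r (Suc i)))))"
      by (rule sum.reindex_bij_witness[of _ "\<lambda>i. i - Suc n" "\<lambda>i. i + Suc n"])
        (auto simp: r_def Suc_diff_le)
    moreover have "{..<n} \<inter> {Suc n..<Suc n + m} = {}" by auto
    ultimately have "(\<Sum>i<n. ennreal (dist (\<gamma> (t i)) (\<gamma> (t (Suc i)))))
        + (\<Sum>i<m. ennreal (dist (\<gamma> (s i)) (\<gamma> (s (Suc i)))))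
        = (\<Sum>i\<in>{..<n} \<union> {Suc n..<Suc n + m}. ennreal (dist (\<gamma> (r i)) (\<gamma> (r (Suc i)))))"
      by (simp only: sum.union_disjoint finite_lessThan finite_atLeastLessThan)
    also have "\<dots> \<le> (\<Sum>i<Suc n + m. ennreal (dist (\<gamma> (r i)) (\<gamma> (r (Suc i)))))"
      by (intro sum_mono2) auto
    also have "\<dots> \<le> path_variation \<gamma> a c"
    proof (rule sum_le_path_variation)
      show "r ` {..Suc n + m} \<subseteq> {a..c}"
      proof
        fix y assume "y \<in> r ` {..Suc n + m}"
        then obtain i where i: "i \<le> Suc n + m" "y = r i" by auto
        show "y \<in> {a..c}"
        proof (cases "i \<le> n")
          case True
          then have "t i \<in> {a..b}" using t(2) by blast
          then show ?thesis using True i assms by (simp add: r_def)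
        next
          case False
          then have "s (i - Suc n) \<in> {b..c}" using s(2) i(1) by (simp add: image_subset_iff)
          then show ?thesis using False i assms by (simp add: r_def)
        qed
      qed
      show "mono_on {..Suc n + m} r"
      proof (rule mono_onI)
        fix i j assume ij: "i \<in> {..Suc n + m}" "j \<in> {..Suc n + m}" "i \<le> j"
        consider "j \<le> n" | "i \<le> n" "n < j" | "n < i" by linarith
        then show "r i \<le> r j"
        proof cases
          case 1 then show ?thesis using ij t(1) by (auto simp: r_def mono_on_def)
        next
          case 2
          then have "t i \<le> b" "b \<le> s (j - Suc n)"
            using t(2) s(2) ij by (auto simp: image_subset_iff)
          then show ?thesis using 2 by (simp add: r_def)
        next
          case 3
          then have "s (i - Suc n) \<le> s (j - Suc n)"
            using ij by (intro mono_onD[OF s(1)]) auto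
          then show ?thesis using 3 ij by (simp add: r_def)
        qed
      qed
    qed
    finally show ?thesis .
  qed
  \<comment> \<open>The suprema are taken one after the other: first over \<open>s\<close> with
    \<open>t\<close> fixed, then over \<open>t\<close>.\<close>
  have "path_variation \<gamma> b c + (\<Sum>i<n. ennreal (dist (\<gamma> (t i)) (\<gamma> (t (Suc i)))))
      \<le> path_variation \<gamma> a c"
    if t: "mono_on {..n} t" "t ` {..n} \<subseteq> {a..b}" for n :: nat and t :: "nat \<Rightarrow> real"
    using concat[OF t] assms by (intro path_variation_add_leI) (auto simp: add.commute)
  then show "path_variation \<gamma> a b + path_variation \<gamma> b c \<le> path_variation \<gamma> a c"
    using assms by (intro path_variation_add_leI) (auto simp: add.commute)
qed

text \<open>By additivity and translation, the piece from \<open>a\<close> to \<open>t + a\<close>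
  has length \<open>(t + a) - a = t\<close>, so arc length parametrization survives restriction. The
  finite length \<open>a\<close> may be cancelled in \<open>ennreal\<close>.\<close>

lemma is_curve_subcurve:
  assumes \<gamma>: "is_curve \<gamma> l" and ab: "0 \<le> a" "a < b" "b \<le> l"
  shows "is_curve (\<lambda>t. \<gamma> (t + a)) (b - a)"
proof -
  have len: "path_variation (\<lambda>t. \<gamma> (t + a)) 0 t = ennreal t" if "t \<in> {0..b - a}" for t
  proof -
    have "path_variation \<gamma> 0 a = ennreal a" "path_variation \<gamma> 0 (t + a) = ennreal (t + a)"
      using \<gamma> ab that by (auto simp: is_curve_def)
    then have "ennreal a + path_variation \<gamma> a (t + a) = ennreal a + ennreal t"
      using path_variation_add[of 0 a "t + a" \<gamma>] ab that by (simp add: add.commute)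
    then have "path_variation \<gamma> a (t + a) = ennreal t"
      by (simp add: ennreal_add_left_cancel)
    then show ?thesis by (simp add: path_variation_shift)
  qed
  have "continuous_on {0..b - a} (\<lambda>t. \<gamma> (t + a))"
    by (rule continuous_on_compose2[of "{0..l}" \<gamma>])
      (use \<gamma> ab in \<open>auto simp: is_curve_def intro!: continuous_intros\<close>)
  moreover have "\<not> (\<lambda>t. \<gamma> (t + a)) constant_on {0..b - a}"
    using path_variation_constant[of "\<lambda>t. \<gamma> (t + a)" 0 "b - a"] len[of "b - a"] ab by auto
  ultimately show ?thesis
    using len ab by (auto simp: is_curve_def)
qed

section \<open>Upper gradients along curves\<close>

text \<open>Only on \<open>{0..l}\<close> is \<gamma> known to be continuous, hence Borel; the
  indicator removes the arbitrary values of \<gamma> elsewhere.\<close>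

lemma measurable_compose_curve:
  fixes g :: "'a::metric_space \<Rightarrow> ennreal"
  assumes "is_curve \<gamma> l" "g \<in> borel_measurable borel"
  shows "(\<lambda>t. g (\<gamma> t) * indicator {0..l} t) \<in> borel_measurable lborel"
proof -
  have "\<gamma> \<in> borel_measurable (restrict_space borel {0..l})"
    using assms(1) by (intro borel_measurable_continuous_on_restrict) (simp add: is_curve_def)
  then have "(\<lambda>t. g (\<gamma> t)) \<in> borel_measurable (restrict_space borel {0..l})"
    using assms(2) by (rule measurable_compose)
  then show ?thesis
    by (subst (asm) borel_measurable_restrict_space_iff_ennreal) auto
qed

text \<open>The upper gradient inequality is applied to the translated subcurve, which starts at
  parameter \<open>0\<close>; the substitution \<open>t + a\<close> brings its integral back to
  \<open>{a..b}\<close>.\<close>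

lemma upper_gradient_subcurve:
  assumes g: "upper_gradient g u" and \<gamma>: "is_curve \<gamma> l" and ab: "0 \<le> a" "a < b" "b \<le> l"
  shows "\<bar>u (\<gamma> a) - u (\<gamma> b)\<bar> \<le> enn2ereal (\<integral>\<^sup>+t\<in>{a..b}. g (\<gamma> t) \<partial>lborel)"
proof -
  have m: "(\<lambda>t. g (\<gamma> t) * indicator {a..b} t) \<in> borel_measurable lborel"
  proof -
    \<comment> \<open>The extra factor for \<open>{0..l}\<close> gives measurability and is then
      absorbed, since \<open>{a..b}\<close> lies inside \<open>{0..l}\<close>.\<close>
    have "(\<lambda>t. g (\<gamma> t) * indicator {0..l} t * indicator {a..b} t) \<in> borel_measurable lborel"
      using measurable_compose_curve[OF \<gamma>, of g] g by (auto simp: upper_gradient_def)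
    also have "(\<lambda>t. g (\<gamma> t) * indicator {0..l} t * indicator {a..b} t)
        = (\<lambda>t. g (\<gamma> t) * indicator {a..b} t)"
      using ab by (auto simp: indicator_def)
    finally show ?thesis .
  qed
  have "\<bar>u (\<gamma> a) - u (\<gamma> b)\<bar> \<le> enn2ereal (curve_integral g (\<lambda>t. \<gamma> (t + a)) (b - a))"
    using g is_curve_subcurve[OF \<gamma> ab] by (force simp: upper_gradient_def)
  also have "curve_integral g (\<lambda>t. \<gamma> (t + a)) (b - a) = (\<integral>\<^sup>+t\<in>{a..b}. g (\<gamma> t) \<partial>lborel)"
    using nn_integral_real_affine[of "\<lambda>t. g (\<gamma> t) * indicator {a..b} t" 1 a] m
    by (auto simp: curve_integral_def indicator_def add.commute intro!: nn_integral_cong)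
  finally show ?thesis .
qed

section \<open>Absolute continuity of the integral\<close>

text \<open>Truncate \<open>f\<close> at a level \<open>n\<close> so high that the excess has
  integral below \<open>\<epsilon> / 2\<close>; over \<open>A\<close> the truncated part contributes
  at most \<open>n\<close> times the measure of \<open>A\<close>.\<close>

lemma nn_integral_absolutely_continuous:
  fixes f :: "'b \<Rightarrow> ennreal" and \<epsilon> :: real
  assumes f: "f \<in> borel_measurable M" and fin: "(\<integral>\<^sup>+x. f x \<partial>M) < \<infinity>" and "0 < \<epsilon>"
  obtains \<delta> :: real where "0 < \<delta>"
    "\<And>A. A \<in> sets M \<Longrightarrow> emeasure M A < ennreal \<delta> \<Longrightarrow> (\<integral>\<^sup>+x\<in>A. f x \<partial>M) < ennreal \<epsilon>"
proof -
  define I where "I n = (\<integral>\<^sup>+x. min (f x) (of_nat n) \<partial>M)" for n :: nat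
  have "(\<integral>\<^sup>+x. f x \<partial>M) = (\<integral>\<^sup>+x. (SUP n. min (f x) (of_nat n)) \<partial>M)"
    by (simp flip: inf_min inf_SUP add: ennreal_SUP_of_nat_eq_top)
  also have "\<dots> = (SUP n. I n)"
    unfolding I_def using f
    by (intro nn_integral_monotone_convergence_SUP) (auto simp: incseq_def le_fun_def min.coboundedI2)
  finally have sup: "(\<integral>\<^sup>+x. f x \<partial>M) = (SUP n. I n)" .
  obtain n where n: "(\<integral>\<^sup>+x. f x \<partial>M) < I n + ennreal (\<epsilon> / 2)"
    using SUP_approx_ennreal[of "\<epsilon> / 2" UNIV _ I, OF _ _ sup] fin \<open>0 < \<epsilon>\<close>
    by (auto simp: less_top)
  show thesis
  proof
    \<comment> \<open>This \<delta> satisfies \<open>n * \<delta> \<le> \<epsilon> / 2\<close>; the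
      added \<open>1\<close> keeps the denominator positive when \<open>n = 0\<close>.\<close>
    show "0 < \<epsilon> / (2 * (real n + 1))" using \<open>0 < \<epsilon>\<close> by simp
    fix A assume A: "A \<in> sets M" "emeasure M A < ennreal (\<epsilon> / (2 * (real n + 1)))"
    have split: "f x = min (f x) (of_nat n) + (f x - min (f x) (of_nat n))" for x
      by (metis add.commute diff_add_cancel_ennreal min.cobounded1)
    have "(\<integral>\<^sup>+x. f x \<partial>M) = I n + (\<integral>\<^sup>+x. f x - min (f x) (of_nat n) \<partial>M)"
      unfolding I_def using f
      by (subst nn_integral_add[symmetric])
        (auto intro!: nn_integral_cong split)
    \<comment> \<open>Cancelling \<open>I n\<close> is legitimate, because the strict inequality
      \<open>n\<close> forces it to be finite.\<close>
    with n have rest: "(\<integral>\<^sup>+x. f x - min (f x) (of_nat n) \<partial>M) < ennreal (\<epsilon> / 2)"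
      by (simp add: ennreal_add_left_cancel_less)
    have "(\<integral>\<^sup>+x\<in>A. f x \<partial>M)
        \<le> (\<integral>\<^sup>+x. (f x - min (f x) (of_nat n)) + of_nat n * indicator A x \<partial>M)"
    proof (rule nn_integral_mono)
      fix x
      have "f x = (f x - min (f x) (of_nat n)) + min (f x) (of_nat n)"
        by (subst add.commute) (rule split)
      also have "\<dots> \<le> (f x - min (f x) (of_nat n)) + of_nat n"
        by (intro add_left_mono) simp
      finally show "f x * indicator A x \<le> (f x - min (f x) (of_nat n)) + of_nat n * indicator A x"
        by (auto simp: indicator_def)
    qed
    also have "\<dots> = (\<integral>\<^sup>+x. f x - min (f x) (of_nat n) \<partial>M) + of_nat n * emeasure M A"
      using f A by (subst nn_integral_add) (auto simp: nn_integral_cmult_indicator)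
    also have "\<dots> < ennreal (\<epsilon> / 2) + ennreal (\<epsilon> / 2)"
    proof -
      have "of_nat n * emeasure M A \<le> of_nat n * ennreal (\<epsilon> / (2 * (real n + 1)))"
        using A(2) by (intro mult_left_mono) auto
      also have "\<dots> = ennreal (real n * (\<epsilon> / (2 * (real n + 1))))"
        using \<open>0 < \<epsilon>\<close> by (simp add: ennreal_of_nat_eq_real_of_nat ennreal_mult'[symmetric])
      also have "\<dots> \<le> ennreal (\<epsilon> / 2)"
        using \<open>0 < \<epsilon>\<close> by (intro ennreal_leI) (simp add: field_simps)
      finally have "of_nat n * emeasure M A + (\<integral>\<^sup>+x. f x - min (f x) (of_nat n) \<partial>M)
          \<le> ennreal (\<epsilon> / 2) + (\<integral>\<^sup>+x. f x - min (f x) (of_nat n) \<partial>M)"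
        by (rule add_right_mono)
      also have "\<dots> < ennreal (\<epsilon> / 2) + ennreal (\<epsilon> / 2)"
        using rest by (simp add: ennreal_add_left_cancel_less del: ennreal_plus)
      finally show ?thesis by (simp add: add.commute)
    qed
    also have "\<dots> = ennreal \<epsilon>" using \<open>0 < \<epsilon>\<close> by (simp flip: ennreal_plus)
    finally show "(\<integral>\<^sup>+x\<in>A. f x \<partial>M) < ennreal \<epsilon>" .
  qed
qed

section \<open>Absolute continuity of functions along curves\<close>

text \<open>Each increment of \<open>u\<close> along \<gamma> is bounded by an integral of
  \<open>g\<close> over the parameter interval. Finiteness of these integrals makes \<open>u\<close>
  real-valued on \<gamma>, and over disjoint intervals they add up to one integral over a set of
  small measure.\<close>

lemma absolutely_continuous_on_curve:
  assumes g: "upper_gradient g u" and \<gamma>: "is_curve \<gamma> l" and fin: "curve_integral g \<gamma> l < \<infinity>"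
  shows "\<forall>t\<in>{0..l}. \<bar>u (\<gamma> t)\<bar> \<noteq> \<infinity>"
    and "absolutely_continuous_on {0..l} (\<lambda>t. real_of_ereal (u (\<gamma> t)))"
proof -
  define G where "G t = g (\<gamma> t) * indicator {0..l} t" for t
  have G: "G \<in> borel_measurable lborel" "(\<integral>\<^sup>+t. G t \<partial>lborel) < \<infinity>"
    using measurable_compose_curve[OF \<gamma>, of g] g fin
    by (auto simp: G_def[abs_def] upper_gradient_def curve_integral_def)
  have le: "\<bar>u (\<gamma> a) - u (\<gamma> b)\<bar> \<le> enn2ereal (\<integral>\<^sup>+t\<in>{a..b}. G t \<partial>lborel)"
    if "0 \<le> a" "a < b" "b \<le> l" for a b
  proof -
    have "(\<integral>\<^sup>+t\<in>{a..b}. g (\<gamma> t) \<partial>lborel) = (\<integral>\<^sup>+t\<in>{a..b}. G t \<partial>lborel)"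
      using that by (intro nn_integral_cong) (auto simp: G_def indicator_def)
    then show ?thesis using upper_gradient_subcurve[OF g \<gamma> that] by simp
  qed
  have int_fin: "(\<integral>\<^sup>+t\<in>A. G t \<partial>lborel) < \<infinity>" for A
    using G(2) by (rule le_less_trans[rotated]) (auto intro!: nn_integral_mono simp: indicator_def)
  have finite_ends: "\<bar>u (\<gamma> a)\<bar> \<noteq> \<infinity>" "\<bar>u (\<gamma> b)\<bar> \<noteq> \<infinity>" if "0 \<le> a" "a < b" "b \<le> l" for a b
  proof -
    have "\<bar>u (\<gamma> a) - u (\<gamma> b)\<bar> \<noteq> \<infinity>"
      using le[OF that] int_fin[of "{a..b}"]
      by (cases "\<integral>\<^sup>+t\<in>{a..b}. G t \<partial>lborel" rule: ennreal_cases) auto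
    \<comment> \<open>The convention for differences of infinite values turns a finite difference
      into finiteness of both terms.\<close>
    then show "\<bar>u (\<gamma> a)\<bar> \<noteq> \<infinity>" "\<bar>u (\<gamma> b)\<bar> \<noteq> \<infinity>"
      using ereal_abs_diff_infinite[of "u (\<gamma> a)" "u (\<gamma> b)"] by auto
  qed
  have "l \<noteq> 0" using \<gamma> by (auto simp: is_curve_def constant_on_def)
  then have "0 < l" using \<gamma> by (auto simp: is_curve_def)
  show real_valued: "\<forall>t\<in>{0..l}. \<bar>u (\<gamma> t)\<bar> \<noteq> \<infinity>"
  proof
    fix t assume "t \<in> {0..l}"
    \<comment> \<open>Endpoint finiteness needs a nondegenerate interval: \<open>{t..l}\<close>
      serves for \<open>t < l\<close>, and \<open>{0..l}\<close> for \<open>t = l\<close>.\<close>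
    with \<open>0 < l\<close> show "\<bar>u (\<gamma> t)\<bar> \<noteq> \<infinity>"
      using finite_ends(1)[of t l] finite_ends(2)[of 0 l] by (cases "t = l") auto
  qed
  have le_real: "ennreal \<bar>real_of_ereal (u (\<gamma> b)) - real_of_ereal (u (\<gamma> a))\<bar>
      \<le> (\<integral>\<^sup>+t\<in>{a<..<b}. G t \<partial>lborel)" if "0 \<le> a" "a < b" "b \<le> l" for a b
  proof -
    have "ennreal \<bar>real_of_ereal (u (\<gamma> b)) - real_of_ereal (u (\<gamma> a))\<bar>
        \<le> (\<integral>\<^sup>+t\<in>{a..b}. G t \<partial>lborel)"
    proof -
      have "ereal \<bar>real_of_ereal (u (\<gamma> b)) - real_of_ereal (u (\<gamma> a))\<bar>
          = \<bar>u (\<gamma> a) - u (\<gamma> b)\<bar>"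
        using finite_ends[OF that] by (cases "u (\<gamma> a)"; cases "u (\<gamma> b)") auto
      then show ?thesis using le[OF that] by (simp add: less_eq_ennreal.rep_eq)
    qed
    \<comment> \<open>Endpoints are null. Open intervals are wanted because those in
      \<open>absolutely_continuous_on\<close> may share endpoints.\<close>
    also have "\<dots> = (\<integral>\<^sup>+t\<in>{a<..<b}. G t \<partial>lborel)"
      using AE_lborel_singleton[of a] AE_lborel_singleton[of b]
      by (intro nn_integral_cong_AE) (auto simp: indicator_def)
    finally show ?thesis .
  qed
  show "absolutely_continuous_on {0..l} (\<lambda>t. real_of_ereal (u (\<gamma> t)))"
    unfolding absolutely_continuous_on_def
  proof (intro allI impI)
    fix \<epsilon> :: real assume "0 < \<epsilon>"
    obtain \<delta> :: real where "0 < \<delta>" and \<delta>: "\<And>A. A \<in> sets lborel \<Longrightarrow> emeasure lborel A < ennreal \<delta> \<Longrightarrow>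
        (\<integral>\<^sup>+t\<in>A. G t \<partial>lborel) < ennreal \<epsilon>"
      using nn_integral_absolutely_continuous[OF G \<open>0 < \<epsilon>\<close>] by blast
    show "\<exists>\<delta>>0. \<forall>D :: (real \<times> real) set.
       finite D \<and> (\<forall>(a, b)\<in>D. a < b \<and> {a..b} \<subseteq> {0..l}) \<and>
       disjoint_family_on (\<lambda>(a, b). {a<..<b}) D \<and> (\<Sum>(a, b)\<in>D. b - a) < \<delta> \<longrightarrow>
       (\<Sum>(a, b)\<in>D. \<bar>real_of_ereal (u (\<gamma> b)) - real_of_ereal (u (\<gamma> a))\<bar>) < \<epsilon>"
    proof (intro exI[of _ \<delta>] conjI allI impI \<open>0 < \<delta>\<close>; elim conjE)
      fix D :: "(real \<times> real) set"
      assume D: "finite D" "\<forall>(a, b)\<in>D. a < b \<and> {a..b} \<subseteq> {0..l}"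
        and disj: "disjoint_family_on (\<lambda>(a, b). {a<..<b}) D"
        and small: "(\<Sum>(a, b)\<in>D. b - a) < \<delta>"
      define J where "J = (\<lambda>(a::real, b). {a<..<b})"
      have J: "J p \<in> sets lborel" for p by (auto simp: J_def split: prod.split)
      have disjJ: "disjoint_family_on J D" using disj by (simp add: J_def)
      have "emeasure lborel (\<Union>p\<in>D. J p) = (\<Sum>p\<in>D. emeasure lborel (J p))"
        using J disjJ D(1) by (intro sum_emeasure[symmetric]) auto
      also have "\<dots> = (\<Sum>p\<in>D. ennreal (snd p - fst p))"
        using D(2) by (intro sum.cong) (auto simp: J_def)
      also have "\<dots> = ennreal (\<Sum>(a, b)\<in>D. b - a)"
        using D(2) by (subst sum_ennreal) (auto simp: case_prod_beta)
      also have "\<dots> < ennreal \<delta>" using small \<open>0 < \<delta>\<close> by (simp add: ennreal_less_iff ennreal_lessI)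
      finally have "(\<integral>\<^sup>+t\<in>(\<Union>p\<in>D. J p). G t \<partial>lborel) < ennreal \<epsilon>"
        using J D(1) by (intro \<delta>) auto
      \<comment> \<open>By disjointness, the indicator of the union is the sum of the
        indicators.\<close>
      also have "(\<integral>\<^sup>+t\<in>(\<Union>p\<in>D. J p). G t \<partial>lborel) = (\<Sum>p\<in>D. \<integral>\<^sup>+t\<in>J p. G t \<partial>lborel)"
        using J G(1) D(1) disjJ
        by (subst nn_integral_sum[symmetric])
          (auto simp: indicator_UN_disjoint sum_distrib_left intro!: nn_integral_cong)
      finally have bound: "(\<Sum>p\<in>D. \<integral>\<^sup>+t\<in>J p. G t \<partial>lborel) < ennreal \<epsilon>" .
      have "ennreal (\<Sum>(a, b)\<in>D. \<bar>real_of_ereal (u (\<gamma> b)) - real_of_ereal (u (\<gamma> a))\<bar>)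
          = (\<Sum>(a, b)\<in>D. ennreal \<bar>real_of_ereal (u (\<gamma> b)) - real_of_ereal (u (\<gamma> a))\<bar>)"
        by (subst sum_ennreal[symmetric]) (auto simp: case_prod_beta)
      also have "\<dots> \<le> (\<Sum>p\<in>D. \<integral>\<^sup>+t\<in>J p. G t \<partial>lborel)"
        using D(2) by (intro sum_mono) (auto simp: J_def intro!: le_real)
      also note bound
      finally show "(\<Sum>(a, b)\<in>D. \<bar>real_of_ereal (u (\<gamma> b)) - real_of_ereal (u (\<gamma> a))\<bar>) < \<epsilon>"
        using \<open>0 < \<epsilon>\<close> by (subst (asm) ennreal_less_iff) (auto intro!: sum_nonneg)
    qed
  qed
qed

section \<open>Modulus of the exceptional family\<close>

text \<open>Scaling \<open>g\<close> by a positive factor leaves its infinite integrals infinite,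
  hence at least \<open>1\<close>, while its finite quasi-norm \<open>K\<close> scales down to
  \<open>0\<close>.\<close>

lemma (in quasi_banach_function_lattice) curve_modulus_eq_0:
  assumes g: "g \<in> borel_measurable borel" "(\<lambda>x. enn2ereal (g x)) \<in> lattice_space M N"
    and inf: "\<And>\<gamma> l. (\<gamma>, l) \<in> \<Gamma> \<Longrightarrow> is_curve \<gamma> l \<and> curve_integral g \<gamma> l = \<infinity>"
  shows "curve_modulus N \<Gamma> = 0"
proof -
  obtain K where K: "0 \<le> K" "N (\<lambda>x. enn2ereal (g x)) = ennreal K"
    using g(2) by (cases "N (\<lambda>x. enn2ereal (g x))" rule: ennreal_cases) (auto simp: lattice_space_def)
  have bound: "curve_modulus N \<Gamma> \<le> ennreal (K / real (Suc n))" for n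
  proof -
    define a where "a = 1 / real (Suc n)"
    have "0 < a" by (simp add: a_def)
    have "curve_integral (\<lambda>x. ennreal a * g x) \<gamma> l = ennreal a * curve_integral g \<gamma> l"
      if "(\<gamma>, l) \<in> \<Gamma>" for \<gamma> l
      using measurable_compose_curve[of \<gamma> l g] inf[OF that] g(1)
      by (simp add: curve_integral_def nn_integral_cmult mult.assoc)
    \<comment> \<open>Positivity of \<open>a\<close> is essential for admissibility: in
      \<open>ennreal\<close> the product of \<open>0\<close> and \<infinity> is
      \<open>0\<close>.\<close>
    then have "curve_modulus N \<Gamma> \<le> N (\<lambda>x. enn2ereal (ennreal a * g x))"
      unfolding curve_modulus_def using g(1) inf \<open>0 < a\<close>
      by (intro INF_lower) (auto simp: ennreal_mult_top)
    also have "(\<lambda>x. enn2ereal (ennreal a * g x)) = (\<lambda>x. ereal a * enn2ereal (g x))"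
      using \<open>0 < a\<close> by (simp add: times_ennreal.rep_eq enn2ereal_ennreal)
    also have "N \<dots> = ennreal \<bar>a\<bar> * N (\<lambda>x. enn2ereal (g x))"
      using g(2) by (intro norm_scale) (simp add: lattice_space_def)
    also have "\<dots> = ennreal (K / real (Suc n))"
      using K by (simp add: a_def ennreal_mult'[symmetric])
    finally show ?thesis .
  qed
  have "(\<lambda>n. ennreal (K / real (Suc n))) \<longlonglongrightarrow> ennreal 0"
    by (intro tendsto_ennrealI LIMSEQ_Suc lim_const_over_n)
  then have "curve_modulus N \<Gamma> \<le> ennreal 0"
    using bound by (intro LIMSEQ_le_const) auto
  then show ?thesis by simp
qed

theorem theorem6p7:
  fixes M :: "'a::metric_space measure"
    and N :: "('a \<Rightarrow> ereal) \<Rightarrow> ennreal"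
    and c :: real
    and u :: "'a \<Rightarrow> ereal"
  assumes "quasi_banach_function_lattice M N c"
    and "u \<in> DX M N"
  shows "u \<in> ACC N"
proof -
  interpret quasi_banach_function_lattice M N c by fact
  obtain g where g: "upper_gradient g u" "(\<lambda>x. enn2ereal (g x)) \<in> lattice_space M N"
    using assms(2) by (auto simp: DX_def)
  show ?thesis
    unfolding ACC_def ae_curve_def mem_Collect_eq
  proof (rule curve_modulus_eq_0)
    show "g \<in> borel_measurable borel" using g(1) by (simp add: upper_gradient_def)
    show "(\<lambda>x. enn2ereal (g x)) \<in> lattice_space M N" by (rule g)
    fix \<gamma> l
    assume "(\<gamma>, l) \<in> {(\<gamma>, l). is_curve \<gamma> l \<and> \<not> ((\<forall>t\<in>{0..l}. \<bar>u (\<gamma> t)\<bar> \<noteq> \<infinity>) \<and>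
        absolutely_continuous_on {0..l} (\<lambda>t. real_of_ereal (u (\<gamma> t))))}"
    \<comment> \<open>Contrapositive: a finite integral would make \<open>u\<close> real-valued and
      absolutely continuous along \<gamma>.\<close>
    then show "is_curve \<gamma> l \<and> curve_integral g \<gamma> l = \<infinity>"
      using absolutely_continuous_on_curve[OF g(1), of \<gamma> l]
      by (cases "curve_integral g \<gamma> l = \<infinity>") (auto simp: less_top[symmetric])
  qed
qed

end
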